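(* Let $P\subset\mathbb{R}^n$ be a simple $n$-dimensional polytope with $0$ in its interior, with facets numbered $1,\dots,m$, and let $\pi:\mathbb{R}^n\to\mathbb{R}^d$ be a surjective linear projection under which all vertices of $P$ are strictly preserved. Then the complement complex $(\partial(P^\Delta))^{c}$ is realized in the boundary of the associated polytope $\mathcal{A}(P,\pi)$; that is, for every vertex $v$ of $P$, the set $\operatorname{conv}\{a_i : i\in[m]\setminus I(v)\}$ is a face of $\mathcal{A}(P,\pi)$.
   Context: $P^\Delta=\{\ell\in(\mathbb{R}^n)^*:\ell(x)\le1\ \forall x\in P\}$ has vertices $\ell_1,\dots,\ell_m$, with $\ell_i$ corresponding to facet $i$ of $P$; for a vertex $v$ of $P$, $I(v)\subseteq[m]$ is the set of facets containing $v$. $\partial(P^\Delta)$ is the simplicial complex (on vertex set $[m]$) of proper faces of the simplicial polytope $P^\Delta$, i.e. the sets $I(F)$ for nonempty faces $F$ of $P$. For a simplicial complex $K\subseteq 2^V$, its complement complex $K^c$ is the simplicial complex generated by the sets $V\setminus\tau$ for facets $\tau$ of $K$. A face $F$ of $P$ is strictly preserved under $\pi$ if $\pi(F)$ is a face of $\pi(P)$ combinatorially isomorphic to $F$ and $\pi^{-1}(\pi(F))\cap P=F$. Let $q:\mathbb{R}^{n-d}\to\mathbb{R}^n$ be injective linear with image $\ker\pi$ and $g_i=q^*(\ell_i)$. When all vertices of $P$ are strictly preserved, $G=\{g_1,\dots,g_m\}$ is a Gale transform (every $G\setminus g_i$ positively spans), and by Gale duality there is a polytope $\mathcal{A}(P,\pi)$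 with vertices $a_1,\dots,a_m$, unique up to affine isomorphism, such that for every $I\subseteq[m]$, $\operatorname{conv}\{a_i: i\in[m]\setminus I\}$ is a face of $\mathcal{A}(P,\pi)$ iff $0$ lies in the relative interior of $\operatorname{conv}\{g_j : j\in I\}$ (i.e. $\{g_j:j\in I\}$ is positively dependent). This is the associated polytope. *)

theory Defs
  imports "HOL-Analysis.Analysis"
begin

text \<open>Throughout, the dual space of a Euclidean space is identified with the space itself via
  the inner product: a vector \<open>l\<close> stands for the linear functional \<open>x \<mapsto> l \<bullet> x\<close>.\<close>

definition polar :: "'a::euclidean_space set \<Rightarrow> 'a set" where
  "polar P = {l. \<forall>x\<in>P. l \<bullet> x \<le> 1}"

definition simple_polytope :: "'a::euclidean_space set \<Rightarrow> bool" where
  "simple_polytope P \<longleftrightarrow> polytope P \<and>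
     (\<forall>v. v extreme_point_of P \<longrightarrow> int (card {F. F facet_of P \<and> v \<in> F}) = aff_dim P)"

definition combinatorially_isomorphic ::
    "'a::euclidean_space set \<Rightarrow> 'b::euclidean_space set \<Rightarrow> bool" where
  "combinatorially_isomorphic P Q \<longleftrightarrow>
     (\<exists>f. bij_betw f {F. F face_of P} {G. G face_of Q} \<and>
          (\<forall>F F'. F face_of P \<longrightarrow> F' face_of P \<longrightarrow> (F \<subseteq> F' \<longleftrightarrow> f F \<subseteq> f F')))"

definition strictly_preserved ::
    "('a::euclidean_space \<Rightarrow> 'b::euclidean_space) \<Rightarrow> 'a set \<Rightarrow> 'a set \<Rightarrow> bool" where
  "strictly_preserved p P F \<longleftrightarrow>
     F face_of P \<and> p ` F face_of p ` P \<and> combinatorially_isomorphic (p ` F) F \<and>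
     p -` (p ` F) \<inter> P = F"

text \<open>A facet numbering of \<open>P\<close> by \<open>{1..m}\<close>, together with the corresponding numbering of the
  vertices of the polar: the vertex \<open>ell i\<close> is the functional whose value on \<open>P\<close> is at most
  \<open>1\<close>, with equality exactly on facet \<open>i\<close>.\<close>

definition facet_numbering ::
    "'a::euclidean_space set \<Rightarrow> nat \<Rightarrow> (nat \<Rightarrow> 'a set) \<Rightarrow> (nat \<Rightarrow> 'a) \<Rightarrow> bool" where
  "facet_numbering P m \<Phi> ell \<longleftrightarrow>
     bij_betw \<Phi> {1..m} {F. F facet_of P} \<and>
     bij_betw ell {1..m} {l. l extreme_point_of polar P} \<and>
     (\<forall>i\<in>{1..m}. \<Phi> i = {x \<in> P. ell i \<bullet> x = 1})"

definition facets_containing :: "nat \<Rightarrow> (nat \<Rightarrow> 'a set) \<Rightarrow> 'a \<Rightarrow> nat set" where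
  "facets_containing m \<Phi> v = {i \<in> {1..m}. v \<in> \<Phi> i}"

text \<open>The complex of proper faces (including the empty one) of a simplicial polytope \<open>Q\<close>
  whose vertices are \<open>w 1, \<dots>, w m\<close>, as an abstract complex on \<open>{1..m}\<close>.\<close>

definition boundary_complex ::
    "nat \<Rightarrow> (nat \<Rightarrow> 'a::euclidean_space) \<Rightarrow> 'a set \<Rightarrow> nat set set" where
  "boundary_complex m w Q =
     {\<sigma>. \<sigma> \<subseteq> {1..m} \<and> convex hull (w ` \<sigma>) face_of Q \<and> convex hull (w ` \<sigma>) \<noteq> Q}"

definition complex_facets :: "'v set set \<Rightarrow> 'v set set" where
  "complex_facets K = {\<tau> \<in> K. \<forall>\<sigma>\<in>K. \<tau> \<subseteq> \<sigma> \<longrightarrow> \<sigma> = \<tau>}"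

definition complement_complex :: "'v set \<Rightarrow> 'v set set \<Rightarrow> 'v set set" where
  "complement_complex V K = {\<sigma>. \<exists>\<tau>\<in>complex_facets K. \<sigma> \<subseteq> V - \<tau>}"

definition realized_in_boundary ::
    "'v set set \<Rightarrow> ('v \<Rightarrow> 'a::euclidean_space) \<Rightarrow> 'a set \<Rightarrow> bool" where
  "realized_in_boundary K a A \<longleftrightarrow>
     (\<forall>\<sigma>\<in>K. convex hull (a ` \<sigma>) face_of A \<and> convex hull (a ` \<sigma>) \<noteq> A)"

text \<open>The adjoint of the restriction of a linear map \<open>q\<close> to a subspace \<open>S\<close>. Working with a
  subspace of a Euclidean space, rather than with a whole type, admits domains of dimension
  \<open>0\<close>; for \<open>S = UNIV\<close> this is the library's \<open>adjoint\<close>.\<close>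

definition adjoint_on ::
    "'c::euclidean_space set \<Rightarrow> ('c \<Rightarrow> 'a::euclidean_space) \<Rightarrow> 'a \<Rightarrow> 'c" where
  "adjoint_on S q l = (THE g. g \<in> S \<and> (\<forall>w\<in>S. w \<bullet> g = q w \<bullet> l))"

lemma adjoint_on_unique:
  fixes q :: "'c::euclidean_space \<Rightarrow> 'a::euclidean_space"
  assumes "linear q" "subspace S"
  shows "\<exists>!g. g \<in> S \<and> (\<forall>w\<in>S. w \<bullet> g = q w \<bullet> l)"
proof -
  obtain y z where yz: "y \<in> span S" "\<And>w. w \<in> span S \<Longrightarrow> orthogonal z w" "adjoint q l = y + z"
    using orthogonal_subspace_decomp_exists[of S "adjoint q l"] by metis
  have S: "span S = S" using assms(2) by (simp add: span_eq_iff)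
  have y: "w \<bullet> y = q w \<bullet> l" if "w \<in> S" for w
  proof -
    have "w \<bullet> z = 0" using yz(2)[of w] that S by (simp add: orthogonal_def inner_commute)
    then show ?thesis using adjoint_works[OF assms(1), of w l] yz(3) by (simp add: inner_add_right)
  qed
  show ?thesis
  proof (rule ex1I[of _ y])
    fix g assume g: "g \<in> S \<and> (\<forall>w\<in>S. w \<bullet> g = q w \<bullet> l)"
    have "g - y \<in> S" using g yz(1) S assms(2) by (simp add: subspace_diff)
    then have "(g - y) \<bullet> (g - y) = 0" using g y by (metis inner_diff_right diff_self)
    then show "g = y" by simp
  qed (use yz(1) y S in auto)
qed

lemma adjoint_on_UNIV:
  assumes "linear q"
  shows "adjoint_on UNIV q = adjoint q"
proof
  fix l
  show "adjoint_on UNIV q l = adjoint q l"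
    unfolding adjoint_on_def
    by (rule the1_equality[OF adjoint_on_unique[OF assms subspace_UNIV]])
       (simp add: adjoint_works[OF assms])
qed

text \<open>\<open>A\<close> has the distinct vertices \<open>a 1, \<dots>, a m\<close>, and its faces are given by Gale duality from
  the configuration \<open>g i = q\<^sup>* (ell i)\<close>. The empty index set is excluded: it
  corresponds to the improper face \<open>A\<close>, while the hull of the empty set has empty relative
  interior, so including it would make the condition unsatisfiable.\<close>

definition associated_polytope ::
    "nat \<Rightarrow> (nat \<Rightarrow> 'a::euclidean_space) \<Rightarrow> 'c::euclidean_space set \<Rightarrow> ('c \<Rightarrow> 'a) \<Rightarrow>
     (nat \<Rightarrow> 'b::euclidean_space) \<Rightarrow> 'b set \<Rightarrow> bool" where
  "associated_polytope m ell S q a A \<longleftrightarrow>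
     polytope A \<and> bij_betw a {1..m} {x. x extreme_point_of A} \<and>
     (\<forall>I. I \<subseteq> {1..m} \<longrightarrow> I \<noteq> {} \<longrightarrow>
        (convex hull (a ` ({1..m} - I)) face_of A \<longleftrightarrow>
         0 \<in> rel_interior (convex hull ((\<lambda>j. adjoint_on S q (ell j)) ` I))))"

end

theory Submission
  imports Defs
begin

text \<open>A strictly preserved vertex \<open>v\<close> of \<open>P\<close> is the unique maximiser over \<open>P\<close> of some functional
  \<open>f\<close> that vanishes on the kernel of the projection. If \<open>I\<close> is any set of facet indices containing
  \<open>I(v)\<close>, then for small \<open>\<epsilon> > 0\<close> the functional \<open>f - \<epsilon> (\<Sum>i\<in>I. ell i)\<close> is still maximised at
  \<open>v\<close>, hence is a nonnegative combination of the \<open>ell i\<close> with \<open>i \<in> I(v)\<close>. So \<open>f\<close> is a strictly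
  positive combination of the \<open>ell i\<close> with \<open>i \<in> I\<close>, and applying \<open>q\<^sup>*\<close> turns this into a positive
  dependence of the Gale vectors \<open>g i\<close>, \<open>i \<in> I\<close>. Allowing \<open>I\<close> to be larger than \<open>I(v)\<close> handles all
  faces of the complement complex at once.\<close>

section \<open>Perturbation, relative interiors of hulls, and polytopes\<close>

text \<open>By continuity each strict inequality survives for all small \<delta> > 0, and finitely
  many such conditions hold together. This serves both to tilt a functional without moving its
  maximiser and to move a point of the polar slightly without leaving it.\<close>

lemma finite_strict_less_perturb:
  fixes f h :: "'a \<Rightarrow> real"
  assumes "finite W" and "\<And>w. w \<in> W \<Longrightarrow> f w < b"
  obtains \<delta> where "\<delta> > 0" and "\<And>w. w \<in> W \<Longrightarrow> f w + \<delta> * h w < b"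
proof -
  have "\<forall>\<^sub>F \<delta> in at_right 0. f w + \<delta> * h w < b" if "w \<in> W" for w
  proof -
    have "((\<lambda>\<delta>. f w + \<delta> * h w) \<longlongrightarrow> f w + 0 * h w) (at_right 0)"
      by (intro tendsto_intros)
    then show ?thesis
      using assms(2)[OF that] by (auto dest: order_tendstoD(2))
  qed
  then have "\<forall>\<^sub>F \<delta> in at_right 0. \<forall>w\<in>W. f w + \<delta> * h w < b"
    using assms(1) by (simp add: eventually_ball_finite)
  then have "\<forall>\<^sub>F \<delta> in at_right 0. 0 < \<delta> \<and> (\<forall>w\<in>W. f w + \<delta> * h w < b)"
    using eventually_at_right_less[of "0::real"] by (rule eventually_conj[rotated])
  then obtain \<delta> where "0 < \<delta> \<and> (\<forall>w\<in>W. f w + \<delta> * h w < b)"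
    using eventually_happens trivial_limit_at_right_real by blast
  then show ?thesis using that by blast
qed

lemma zero_in_rel_interior_convex_hull_image:
  fixes g :: "'i \<Rightarrow> 'a::euclidean_space"
  assumes "finite I" "I \<noteq> {}" and pos: "\<And>i. i \<in> I \<Longrightarrow> 0 < c i"
    and "(\<Sum>i\<in>I. c i *\<^sub>R g i) = 0"
  shows "0 \<in> rel_interior (convex hull (g ` I))"
proof -
  define s where "s = sum c I"
  have s: "s > 0" unfolding s_def using assms by (intro sum_pos) auto
  have "0 = (\<Sum>i\<in>I. (c i / s) *\<^sub>R g i)"
    using assms(4) by (simp add: divide_inverse_commute flip: scaleR_scaleR scaleR_sum_right)
  moreover have "sum (\<lambda>i. c i / s) I = 1"
    using s by (simp add: s_def flip: sum_divide_distrib)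
  moreover have "\<forall>i\<in>I. c i / s > 0" using pos s by simp
  \<comment> \<open>Viewing the generators as a union of singletons indexed by \<open>I\<close>
    makes the strictly positive convex combinations the relative interior, even when some of the
    \<open>g i\<close> coincide.\<close>
  moreover have "\<Union>((\<lambda>i. {g i}) ` I) = g ` I" by auto
  ultimately show ?thesis
    using rel_interior_convex_hull_union[OF assms(1), of "\<lambda>i. {g i}"] by fastforce
qed

lemma polytope_eq_hull_vertices:
  fixes P :: "'a::euclidean_space set"
  assumes "polytope P"
  shows "P = convex hull {v. v extreme_point_of P}"
  using assms by (intro Krein_Milman_Minkowski polytope_imp_compact polytope_imp_convex)

lemma polytope_inner_le:
  fixes P :: "'a::euclidean_space set"
  assumes "polytope P" and "\<And>v. v extreme_point_of P \<Longrightarrow> l \<bullet> v \<le> b" and "x \<in> P"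
  shows "l \<bullet> x \<le> b"
proof -
  have "convex hull {v. v extreme_point_of P} \<subseteq> {x. l \<bullet> x \<le> b}"
    using assms(2) by (intro hull_minimal) (auto simp: convex_halfspace_le)
  then show ?thesis using assms(3) polytope_eq_hull_vertices[OF assms(1)] by auto
qed

lemma finite_polytope_vertices:
  fixes P :: "'a::euclidean_space set"
  assumes "polytope P" shows "finite {v. v extreme_point_of P}"
  using assms by (simp add: finite_polyhedron_extreme_points polytope_imp_polyhedron)

section \<open>The polar and its faces cut out by points of P\<close>

lemma convex_polar: "convex (polar P)"
proof -
  have "polar P = (\<Inter>x\<in>P. {l. x \<bullet> l \<le> 1})" by (auto simp: polar_def inner_commute)
  then show ?thesis by (auto intro!: convex_INT convex_halfspace_le)
qed

text \<open>Compactness lets faces of the polar be recovered from their extreme points by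
  Krein-Milman, without first showing that the polar is a polytope.\<close>

lemma compact_polar:
  fixes P :: "'a::euclidean_space set"
  assumes "0 \<in> interior P"
  shows "compact (polar P)"
proof -
  have "polar P = (\<Inter>x\<in>P. {l. x \<bullet> l \<le> 1})" by (auto simp: polar_def inner_commute)
  then have "closed (polar P)" by (auto intro!: closed_INT closed_halfspace_le)
  moreover have "bounded (polar P)"
  proof -
    obtain e where e: "e > 0" "cball 0 e \<subseteq> P"
      using assms mem_interior_cball by blast
    have "norm l \<le> 1 / e" if l: "l \<in> polar P" for l
    proof (cases "l = 0")
      case False
      \<comment> \<open>Testing \<open>l\<close> on the vector of length \<open>e\<close> in its own
        direction gives \<open>e * norm l\<close> \<le> 1.\<close>
      have "(e / norm l) *\<^sub>R l \<in> P" using e False by (intro subsetD[OF e(2)]) auto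
      then have "l \<bullet> ((e / norm l) *\<^sub>R l) \<le> 1" using l by (auto simp: polar_def)
      then have "e * norm l \<le> 1"
        using False by (simp add: dot_square_norm power2_eq_square)
      then show ?thesis using e by (simp add: field_simps)
    qed (use e in simp)
    then show ?thesis by (auto simp: bounded_iff)
  qed
  ultimately show ?thesis by (simp add: compact_eq_bounded_closed)
qed

lemma polar_vertex_face:
  fixes P :: "'a::euclidean_space set"
  assumes "v \<in> P"
  shows "{l \<in> polar P. l \<bullet> v = 1} face_of polar P"
proof -
  have "polar P \<inter> {l. v \<bullet> l = 1} face_of polar P"
    using assms by (intro face_of_Int_supporting_hyperplane_le convex_polar)
      (auto simp: polar_def inner_commute)
  moreover have "polar P \<inter> {l. v \<bullet> l = 1} = {l \<in> polar P. l \<bullet> v = 1}"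
    by (auto simp: inner_commute)
  ultimately show ?thesis by simp
qed

lemma polar_vertex_face_eq_hull:
  fixes P :: "'a::euclidean_space set"
  assumes "0 \<in> interior P" "v \<in> P"
  shows "{l \<in> polar P. l \<bullet> v = 1} = convex hull {l. l extreme_point_of polar P \<and> l \<bullet> v = 1}"
    (is "?F = _")
proof -
  note F = polar_vertex_face[OF assms(2)]
  have "compact ?F" "convex ?F"
    using F compact_polar[OF assms(1)] convex_polar face_of_imp_compact face_of_imp_convex by blast+
  then have "?F = convex hull {l. l extreme_point_of ?F}"
    by (rule Krein_Milman_Minkowski)
  also have "{l. l extreme_point_of ?F} = {l. l extreme_point_of polar P \<and> l \<bullet> v = 1}"
    using extreme_point_of_face[OF F] by (auto simp: extreme_point_of_def)
  finally show ?thesis .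
qed

text \<open>This describes the normal cone of P at \<open>v\<close>. A nonzero \<open>h\<close> can
  be scaled to have value 1 at \<open>v\<close>; it then lies in the face of the polar spanned by
  \<open>E\<close>, and scaling the convex weights back gives conic ones.\<close>

lemma maximised_at_imp_conic_combination:
  fixes P :: "'a::euclidean_space set"
  assumes P: "0 \<in> interior P" and v: "v \<in> P"
    and E: "E = {l. l extreme_point_of polar P \<and> l \<bullet> v = 1}" "finite E"
    and max: "\<And>x. x \<in> P \<Longrightarrow> h \<bullet> x \<le> h \<bullet> v"
  obtains \<mu> where "\<And>l. l \<in> E \<Longrightarrow> 0 \<le> \<mu> l" and "h = (\<Sum>l\<in>E. \<mu> l *\<^sub>R l)"
proof (cases "h = 0")
  case True
  then show ?thesis using that[of "\<lambda>_. 0"] by simp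
next
  case False
  obtain e where e: "e > 0" "cball 0 e \<subseteq> P"
    using P mem_interior_cball by blast
  \<comment> \<open>Since 0 is interior, \<open>h\<close> is positive somewhere on P, so its maximum
    \<open>h \<bullet> v\<close> is a legitimate divisor.\<close>
  have "(e / norm h) *\<^sub>R h \<in> P" using e False by (intro subsetD[OF e(2)]) auto
  then have "h \<bullet> ((e / norm h) *\<^sub>R h) \<le> h \<bullet> v" by (rule max)
  moreover have "h \<bullet> ((e / norm h) *\<^sub>R h) > 0" using e False by simp
  ultimately have hv: "h \<bullet> v > 0" by linarith
  have "(1 / (h \<bullet> v)) *\<^sub>R h \<in> {l \<in> polar P. l \<bullet> v = 1}"
    using hv max by (auto simp: polar_def field_simps)
  then have "(1 / (h \<bullet> v)) *\<^sub>R h \<in> convex hull E"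
    using polar_vertex_face_eq_hull[OF P v] E by simp
  then obtain u where u: "\<And>l. l \<in> E \<Longrightarrow> 0 \<le> u l" "(\<Sum>l\<in>E. u l *\<^sub>R l) = (1 / (h \<bullet> v)) *\<^sub>R h"
    using E(2) by (auto simp: convex_hull_finite)
  have "(\<Sum>l\<in>E. ((h \<bullet> v) * u l) *\<^sub>R l) = (h \<bullet> v) *\<^sub>R (\<Sum>l\<in>E. u l *\<^sub>R l)"
    by (simp add: scaleR_sum_right)
  also have "\<dots> = h" using hv u(2) by simp
  finally show ?thesis using that[of "\<lambda>l. (h \<bullet> v) * u l"] u(1) hv by simp
qed

section \<open>Positive combinations of the facet functionals\<close>

lemma mem_facets_containing_iff:
  assumes "facet_numbering P m \<Phi> ell" "v \<in> P"
  shows "i \<in> facets_containing m \<Phi> v \<longleftrightarrow> i \<in> {1..m} \<and> ell i \<bullet> v = 1"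
  using assms unfolding facet_numbering_def facets_containing_def by auto

lemma ell_image_facets_containing:
  assumes "facet_numbering P m \<Phi> ell" "v \<in> P"
  shows "ell ` facets_containing m \<Phi> v = {l. l extreme_point_of polar P \<and> l \<bullet> v = 1}"
proof -
  have "ell ` {1..m} = {l. l extreme_point_of polar P}"
    using assms(1) by (simp add: facet_numbering_def bij_betw_def)
  then have "{l. l extreme_point_of polar P \<and> l \<bullet> v = 1} = {l \<in> ell ` {1..m}. l \<bullet> v = 1}"
    by simp
  then show ?thesis using mem_facets_containing_iff[OF assms] by auto
qed

lemma unique_maximiser_imp_positive_combination:
  fixes P :: "'a::euclidean_space set"
  assumes P: "polytope P" "0 \<in> interior P" and num: "facet_numbering P m \<Phi> ell"
    and v: "v \<in> P"
    and max: "\<And>x. x \<in> P \<Longrightarrow> x \<noteq> v \<Longrightarrow> f \<bullet> x < f \<bullet> v"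
    and I: "facets_containing m \<Phi> v \<subseteq> I" "I \<subseteq> {1..m}"
  obtains c where "\<And>i. i \<in> I \<Longrightarrow> 0 < c i" and "f = (\<Sum>i\<in>I. c i *\<^sub>R ell i)"
proof -
  define s where "s = (\<Sum>i\<in>I. ell i)"
  define J where "J = facets_containing m \<Phi> v"
  have fin: "finite I" using I(2) by (rule finite_subset) simp
  have "finite J" using I(1) fin unfolding J_def by (rule finite_subset)
  have "inj_on ell {1..m}" using num by (simp add: facet_numbering_def bij_betw_def)
  moreover have "J \<subseteq> {1..m}" using I unfolding J_def by (rule order_trans)
  ultimately have inj: "inj_on ell J" by (rule inj_on_subset)
  obtain \<delta> where \<delta>: "\<delta> > 0"
    "\<And>w. w \<in> {w. w extreme_point_of P} - {v} \<Longrightarrow> f \<bullet> (w - v) + \<delta> * (- (s \<bullet> (w - v))) < 0"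
  proof (rule finite_strict_less_perturb[of "{w. w extreme_point_of P} - {v}"
        "\<lambda>w. f \<bullet> (w - v)" 0 "\<lambda>w. - (s \<bullet> (w - v))"])
    show "finite ({w. w extreme_point_of P} - {v})" using finite_polytope_vertices[OF P(1)] by simp
  qed (use max in \<open>auto simp: inner_diff_right extreme_point_of_def\<close>)
  define h where "h = f - \<delta> *\<^sub>R s"
  have "h \<bullet> w \<le> h \<bullet> v" if "w extreme_point_of P" for w
    using \<delta>(2)[of w] that by (cases "w = v") (auto simp: h_def algebra_simps)
  then have hmax: "h \<bullet> x \<le> h \<bullet> v" if "x \<in> P" for x
    using polytope_inner_le[OF P(1)] that by blast
  have "finite (ell ` J)" using \<open>finite J\<close> by simp
  then obtain \<mu> where \<mu>: "\<And>l. l \<in> ell ` J \<Longrightarrow> 0 \<le> \<mu> l" "h = (\<Sum>l\<in>ell ` J. \<mu> l *\<^sub>R l)"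
    using maximised_at_imp_conic_combination[OF P(2) v
        ell_image_facets_containing[OF num v, folded J_def] _ hmax] by metis
  \<comment> \<open>Adding back \<delta> times the sum \<open>s\<close> gives every index of
    \<open>I\<close> at least \<delta>; the conic weights of \<open>h\<close> contribute only on
    \<open>J\<close>.\<close>
  define c where "c i = \<delta> + (if i \<in> J then \<mu> (ell i) else 0)" for i
  have "h = (\<Sum>i\<in>J. \<mu> (ell i) *\<^sub>R ell i)" using \<mu>(2) inj by (simp add: sum.reindex)
  also have "\<dots> = (\<Sum>i\<in>I. (if i \<in> J then \<mu> (ell i) else 0) *\<^sub>R ell i)"
    using I(1) fin by (intro sum.mono_neutral_cong_left) (auto simp: J_def)
  finally have "(\<Sum>i\<in>I. c i *\<^sub>R ell i) = \<delta> *\<^sub>R s + h"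
    by (simp add: s_def c_def scaleR_add_left sum.distrib scaleR_sum_right)
  then have "f = (\<Sum>i\<in>I. c i *\<^sub>R ell i)" by (simp add: h_def)
  moreover have "0 < c i" for i using \<delta>(1) \<mu>(1) by (simp add: c_def add_pos_nonneg)
  ultimately show ?thesis by (intro that)
qed

section \<open>From the projection to the Gale vectors\<close>

lemma strictly_preserved_vertex_functional:
  fixes p :: "'a::euclidean_space \<Rightarrow> 'b::euclidean_space"
  assumes "polytope P" "linear p" "strictly_preserved p P {v}"
  obtains f where "\<And>w. p w = 0 \<Longrightarrow> f \<bullet> w = 0"
    and "\<And>x. x \<in> P \<Longrightarrow> x \<noteq> v \<Longrightarrow> f \<bullet> x < f \<bullet> v"
proof -
  have sp: "{p v} face_of p ` P" "p -` {p v} \<inter> P = {v}"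
    using assms(3) by (auto simp: strictly_preserved_def)
  have "{p v} exposed_face_of p ` P"
    using assms sp(1)
    by (simp add: exposed_face_of_polyhedron polytope_imp_polyhedron polytope_linear_image)
  then obtain c b where cb: "p ` P \<subseteq> {y. c \<bullet> y \<le> b}" "{p v} = p ` P \<inter> {y. c \<bullet> y = b}"
    unfolding exposed_face_of_def by blast
  have adj: "adjoint p c \<bullet> x = c \<bullet> p x" for x
    using adjoint_works[OF assms(2), of x c] by (simp add: inner_commute)
  show ?thesis
  proof
    show "adjoint p c \<bullet> w = 0" if "p w = 0" for w using adj that by simp
    show "adjoint p c \<bullet> x < adjoint p c \<bullet> v" if x: "x \<in> P" "x \<noteq> v" for x
    proof -
      have "p x \<noteq> p v" using sp(2) x by blast
      then have "c \<bullet> p x \<noteq> b" using cb(2) x by blast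
      moreover have "c \<bullet> p x \<le> b" "c \<bullet> p v = b" using cb x by auto
      ultimately show ?thesis by (simp add: adj)
    qed
  qed
qed

text \<open>The combination lies in \<open>S\<close> and is orthogonal to all of \<open>S\<close>,
  hence to itself.\<close>

lemma sum_adjoint_on_eq_0:
  fixes q :: "'c::euclidean_space \<Rightarrow> 'a::euclidean_space"
  assumes q: "linear q" "subspace S"
    and vanish: "\<And>w. w \<in> S \<Longrightarrow> (\<Sum>i\<in>I. c i *\<^sub>R l i) \<bullet> q w = 0"
  shows "(\<Sum>i\<in>I. c i *\<^sub>R adjoint_on S q (l i)) = 0" (is "?g = 0")
proof -
  have adj: "adjoint_on S q k \<in> S \<and> (\<forall>w\<in>S. w \<bullet> adjoint_on S q k = q w \<bullet> k)" for k
    unfolding adjoint_on_def by (rule theI'[OF adjoint_on_unique[OF q]])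
  have "w \<bullet> ?g = (\<Sum>i\<in>I. c i *\<^sub>R l i) \<bullet> q w" if "w \<in> S" for w
    using adj that by (simp add: inner_sum_right inner_sum_left inner_commute)
  moreover have "?g \<in> S" using adj q(2) by (intro subspace_sum subspace_scale) auto
  ultimately have "?g \<bullet> ?g = 0" using vanish by metis
  then show ?thesis by simp
qed

section \<open>Facets of the boundary complex and vertices of P\<close>

lemma facets_containing_in_boundary_complex:
  fixes P :: "'a::euclidean_space set"
  assumes "0 \<in> interior P" "facet_numbering P m \<Phi> ell" "v \<in> P"
  shows "facets_containing m \<Phi> v \<in> boundary_complex m ell (polar P)"
proof -
  have eq: "convex hull (ell ` facets_containing m \<Phi> v) = {l \<in> polar P. l \<bullet> v = 1}"
    using polar_vertex_face_eq_hull[OF assms(1,3)] ell_image_facets_containing[OF assms(2,3)] by simp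
  moreover have "{l \<in> polar P. l \<bullet> v = 1} \<noteq> polar P"
  proof -
    have "0 \<in> polar P" by (simp add: polar_def)
    moreover have "0 \<notin> {l \<in> polar P. l \<bullet> v = 1}" by simp
    ultimately show ?thesis by blast
  qed
  moreover have "facets_containing m \<Phi> v \<subseteq> {1..m}" by (auto simp: facets_containing_def)
  ultimately show ?thesis
    using polar_vertex_face[OF assms(3)] unfolding boundary_complex_def by auto
qed

text \<open>If every vertex \<open>v\<close> had some \<open>l \<in> G\<close> with \<open>l \<bullet> v < 1\<close>, then averaging these functionals would
  give a point of \<open>G\<close> in the interior of the polar.\<close>

lemma proper_polar_face_subset_vertex_face:
  fixes P :: "'a::euclidean_space set"
  assumes P: "polytope P" "P \<noteq> {}" and G: "G face_of polar P" "G \<noteq> polar P"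
  obtains v where "v extreme_point_of P" and "\<And>l. l \<in> G \<Longrightarrow> l \<bullet> v = 1"
proof -
  define W where "W = {v. v extreme_point_of P}"
  have W: "finite W" "W \<noteq> {}"
    using finite_polytope_vertices[OF P(1)] polytope_eq_hull_vertices[OF P(1)] P(2)
    by (auto simp: W_def)
  have WP: "W \<subseteq> P" by (auto simp: W_def extreme_point_of_def)
  have GP: "G \<subseteq> polar P" using G(1) face_of_imp_subset by blast
  have "\<exists>v\<in>W. \<forall>l\<in>G. l \<bullet> v = 1"
  proof (rule ccontr)
    assume "\<not> ?thesis"
    then have "\<forall>v\<in>W. \<exists>l\<in>G. l \<bullet> v \<noteq> 1" by blast
    then obtain L where L: "\<And>v. v \<in> W \<Longrightarrow> L v \<in> G \<and> L v \<bullet> v \<noteq> 1" by metis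
    have le: "L v \<bullet> w \<le> 1" if "v \<in> W" "w \<in> W" for v w
      using L GP WP that by (auto simp: polar_def)
    define k where "k = 1 / real (card W)"
    have k: "k > 0" "(\<Sum>v\<in>W. k) = 1" using W by (auto simp: k_def card_gt_0_iff)
    define l where "l = (\<Sum>v\<in>W. k *\<^sub>R L v)"
    have lG: "l \<in> G"
      unfolding l_def using W k L face_of_imp_convex[OF G(1)] by (intro convex_sum) auto
    \<comment> \<open>At each vertex \<open>w\<close> every term of the average is at most
      \<open>k\<close>, and the term of \<open>L w\<close> is strictly smaller.\<close>
    have lt: "l \<bullet> w < 1" if w: "w \<in> W" for w
    proof -
      have "l \<bullet> w = (\<Sum>v\<in>W. k * (L v \<bullet> w))" by (simp add: l_def inner_sum_left)
      also have "\<dots> < (\<Sum>v\<in>W. k)"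
      proof (rule sum_strict_mono_ex1)
        show "\<forall>v\<in>W. k * (L v \<bullet> w) \<le> k" using le w k by (simp add: mult_left_le)
        have "L w \<bullet> w < 1" using le[OF w w] L[OF w] by linarith
        then show "\<exists>v\<in>W. k * (L v \<bullet> w) < k" using w k by (intro bexI[of _ w]) auto
      qed (use W in auto)
      finally show ?thesis using k by simp
    qed
    have "l' \<in> G" if l': "l' \<in> polar P" for l'
    proof (cases "l' = l")
      case False
      obtain \<delta> where \<delta>: "\<delta> > 0" "\<And>w. w \<in> W \<Longrightarrow> l \<bullet> w + \<delta> * ((l - l') \<bullet> w) < 1"
        using finite_strict_less_perturb[OF W(1), of "\<lambda>w. l \<bullet> w" 1 "\<lambda>w. (l - l') \<bullet> w"] lt by blast
      \<comment> \<open>\<open>y\<close> lies just beyond \<open>l\<close> on the ray from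
        \<open>l'\<close> through \<open>l\<close>, still inside the polar. As \<open>l\<close> is
        then interior to a segment of the polar, the face property forces \<open>l'\<close> into
        \<open>G\<close>.\<close>
      define y where "y = l + \<delta> *\<^sub>R (l - l')"
      have "y \<bullet> w \<le> 1" if "w extreme_point_of P" for w
        using \<delta>(2)[of w] that by (simp add: y_def W_def inner_add_left)
      then have "y \<in> polar P" using polytope_inner_le[OF P(1)] by (auto simp: polar_def)
      moreover have "l \<in> open_segment l' y"
      proof -
        have "(1 + \<delta>) *\<^sub>R l = \<delta> *\<^sub>R l' + y" by (simp add: y_def algebra_simps)
        then have "l = (1 / (1 + \<delta>)) *\<^sub>R (\<delta> *\<^sub>R l' + y)"
          using \<delta>(1) by (simp flip: \<open>(1 + \<delta>) *\<^sub>R l = \<delta> *\<^sub>R l' + y\<close>)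
        then have "l = (1 - 1 / (1 + \<delta>)) *\<^sub>R l' + (1 / (1 + \<delta>)) *\<^sub>R y"
          using \<delta>(1) by (simp add: scaleR_add_right field_simps)
        moreover have "l' \<noteq> y"
        proof
          assume "l' = y"
          then have "(1 + \<delta>) *\<^sub>R (l - l') = 0" by (simp add: y_def algebra_simps)
          then show False using \<delta>(1) False by simp
        qed
        ultimately show ?thesis
          using \<delta>(1) unfolding in_segment by (intro conjI exI[of _ "1 / (1 + \<delta>)"]) auto
      qed
      ultimately show ?thesis using G(1) l' lG unfolding face_of_def by blast
    qed (use lG in simp)
    then show False using G(2) GP by blast
  qed
  then show ?thesis using that by (auto simp: W_def)
qed

text \<open>A proper face of the polar lies in the face of some vertex \<open>v\<close> of P, and
  the index set of that face belongs to the complex; maximality of \<tau> turns the inclusion into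
  equality.\<close>

lemma complex_facet_of_polar_eq_facets_containing:
  fixes P :: "'a::euclidean_space set"
  assumes P: "polytope P" "0 \<in> interior P" and num: "facet_numbering P m \<Phi> ell"
    and \<tau>: "\<tau> \<in> complex_facets (boundary_complex m ell (polar P))"
  obtains v where "v extreme_point_of P" and "\<tau> = facets_containing m \<Phi> v"
proof -
  have \<tau>K: "\<tau> \<subseteq> {1..m}" "convex hull (ell ` \<tau>) face_of polar P" "convex hull (ell ` \<tau>) \<noteq> polar P"
    using \<tau> by (auto simp: complex_facets_def boundary_complex_def)
  have "P \<noteq> {}" using P(2) by auto
  then obtain v where v: "v extreme_point_of P" "\<And>l. l \<in> convex hull (ell ` \<tau>) \<Longrightarrow> l \<bullet> v = 1"
    using proper_polar_face_subset_vertex_face[OF P(1) _ \<tau>K(2,3)] by blast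
  have vP: "v \<in> P" using v(1) by (simp add: extreme_point_of_def)
  have "\<tau> \<subseteq> facets_containing m \<Phi> v"
    using mem_facets_containing_iff[OF num vP] \<tau>K(1) v(2) by (auto simp: hull_inc)
  then have "\<tau> = facets_containing m \<Phi> v"
    using \<tau> facets_containing_in_boundary_complex[OF P(2) num vP]
    by (auto simp: complex_facets_def)
  then show ?thesis using that v(1) by blast
qed

text \<open>Needed because the Gale condition is stated for nonempty index sets only. With no facet
  through \<open>v\<close>, a functional exposing \<open>v\<close> would be an empty sum, hence
  zero.\<close>

lemma facets_containing_nonempty:
  fixes P :: "'a::euclidean_space set"
  assumes P: "polytope P" "0 \<in> interior P" and num: "facet_numbering P m \<Phi> ell"
    and v: "v extreme_point_of P"
  shows "facets_containing m \<Phi> v \<noteq> {}"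
proof -
  have vP: "v \<in> P" using v by (simp add: extreme_point_of_def)
  have "v \<noteq> 0" using v P(2) by (metis extreme_point_not_in_interior)
  obtain c b where cb: "P \<subseteq> {x. c \<bullet> x \<le> b}" "{v} = P \<inter> {x. c \<bullet> x = b}"
    using v P(1) by (metis exposed_face_of_def exposed_face_of_polyhedron face_of_singleton
        polytope_imp_polyhedron)
  have "c \<bullet> x < c \<bullet> v" if "x \<in> P" "x \<noteq> v" for x
  proof -
    have "c \<bullet> x \<noteq> b" using cb(2) that by blast
    moreover have "c \<bullet> x \<le> b" "c \<bullet> v = b" using cb that by auto
    ultimately show ?thesis by simp
  qed
  moreover have "facets_containing m \<Phi> v \<subseteq> {1..m}"
    by (auto simp: facets_containing_def)
  ultimately obtain u where "c = (\<Sum>i\<in>facets_containing m \<Phi> v. u i *\<^sub>R ell i)"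
    using unique_maximiser_imp_positive_combination[OF P num vP, of c, OF _ order_refl] by metis
  then have "c = 0" if "facets_containing m \<Phi> v = {}" using that by simp
  \<comment> \<open>Otherwise 0, a point of P, would lie on the hyperplane that meets P in
    \<open>v\<close> alone. This excludes \<open>c = 0\<close>, which would give
    \<open>b = 0\<close>.\<close>
  moreover have "c \<bullet> 0 \<noteq> b" using cb(2) \<open>v \<noteq> 0\<close> P(2) interior_subset by fastforce
  moreover have "c \<bullet> v = b" using cb(2) by blast
  ultimately show ?thesis by auto
qed

section \<open>Faces of the associated polytope\<close>

lemma associated_polytope_face:
  fixes P :: "'a::euclidean_space set" and p :: "'a \<Rightarrow> 'b::euclidean_space"
    and q :: "'c::euclidean_space \<Rightarrow> 'a" and a :: "nat \<Rightarrow> 'e::euclidean_space"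
  assumes P: "polytope P" "0 \<in> interior P" and num: "facet_numbering P m \<Phi> ell"
    and p: "linear p" and v: "v extreme_point_of P" "strictly_preserved p P {v}"
    and q: "subspace S" "linear q" "q ` S \<subseteq> {x. p x = 0}"
    and A: "associated_polytope m ell S q a A"
    and I: "facets_containing m \<Phi> v \<subseteq> I" "I \<subseteq> {1..m}"
  shows "convex hull (a ` ({1..m} - I)) face_of A"
proof -
  have vP: "v \<in> P" using v(1) by (simp add: extreme_point_of_def)
  obtain f where f: "\<And>w. p w = 0 \<Longrightarrow> f \<bullet> w = 0" "\<And>x. x \<in> P \<Longrightarrow> x \<noteq> v \<Longrightarrow> f \<bullet> x < f \<bullet> v"
    using strictly_preserved_vertex_functional[OF P(1) p v(2)] by blast
  obtain c where c: "\<And>i. i \<in> I \<Longrightarrow> 0 < c i" "f = (\<Sum>i\<in>I. c i *\<^sub>R ell i)"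
    using unique_maximiser_imp_positive_combination[OF P num vP f(2) I] by blast
  have "I \<noteq> {}" using facets_containing_nonempty[OF P num v(1)] I by blast
  moreover have "(\<Sum>i\<in>I. c i *\<^sub>R adjoint_on S q (ell i)) = 0"
    using q f(1) c(2) by (intro sum_adjoint_on_eq_0) auto
  moreover have "finite I" using I(2) by (rule finite_subset) simp
  ultimately have "0 \<in> rel_interior (convex hull ((\<lambda>j. adjoint_on S q (ell j)) ` I))"
    using c(1) zero_in_rel_interior_convex_hull_image[of I c "\<lambda>j. adjoint_on S q (ell j)"] by blast
  then show ?thesis using A I(2) \<open>I \<noteq> {}\<close> unfolding associated_polytope_def by blast
qed

lemma associated_polytope_hull_proper:
  assumes "associated_polytope m ell S q a A" "\<sigma> \<subset> {1..m}"
  shows "convex hull (a ` \<sigma>) \<noteq> A"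
proof
  assume eq: "convex hull (a ` \<sigma>) = A"
  have a: "bij_betw a {1..m} {x. x extreme_point_of A}"
    using assms(1) by (simp add: associated_polytope_def)
  have "a ` {1..m} \<subseteq> a ` \<sigma>"
    using a eq extreme_point_of_convex_hull unfolding bij_betw_def by blast
  then show False
    using assms(2) a unfolding bij_betw_def by (metis inj_on_image_subset_iff order_refl psubsetE)
qed

theorem theorem3p11:
  fixes P :: "(real ^ 'n) set"
    and p :: "real ^ 'n \<Rightarrow> real ^ 'd"
    and m :: nat
    and \<Phi> :: "nat \<Rightarrow> (real ^ 'n) set"
    and ell :: "nat \<Rightarrow> real ^ 'n"
    and S :: "(real ^ 'k) set"
    and q :: "real ^ 'k \<Rightarrow> real ^ 'n"
    and a :: "nat \<Rightarrow> real ^ 'e"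
    and A :: "(real ^ 'e) set"
  assumes "simple_polytope P" and "aff_dim P = int CARD('n)" and "0 \<in> interior P"
    and "facet_numbering P m \<Phi> ell"
    and "linear p" and "surj p"
    and "\<forall>v. v extreme_point_of P \<longrightarrow> strictly_preserved p P {v}"
    and "subspace S" and "dim S = CARD('n) - CARD('d)"
    and "linear q" and "inj_on q S" and "q ` S = {x. p x = 0}"
    and "associated_polytope m ell S q a A"
  shows "realized_in_boundary (complement_complex {1..m} (boundary_complex m ell (polar P))) a A \<and>
    (\<forall>v. v extreme_point_of P \<longrightarrow>
      convex hull (a ` ({1..m} - facets_containing m \<Phi> v)) face_of A)"
proof -
  have P: "polytope P" using assms(1) by (simp add: simple_polytope_def)
  have face: "convex hull (a ` ({1..m} - I)) face_of A"
    if "v extreme_point_of P" "facets_containing m \<Phi> v \<subseteq> I" "I \<subseteq> {1..m}" for v I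
    using associated_polytope_face[OF P assms(3,4,5) that(1) _ assms(8,10) _ assms(13) that(2,3)]
      assms(7,12) that(1) by blast
  have "convex hull (a ` \<sigma>) face_of A \<and> convex hull (a ` \<sigma>) \<noteq> A"
    if \<sigma>: "\<sigma> \<in> complement_complex {1..m} (boundary_complex m ell (polar P))" for \<sigma>
  proof -
    obtain \<tau> where \<tau>: "\<tau> \<in> complex_facets (boundary_complex m ell (polar P))" "\<sigma> \<subseteq> {1..m} - \<tau>"
      using \<sigma> by (auto simp: complement_complex_def)
    obtain v where v: "v extreme_point_of P" "\<tau> = facets_containing m \<Phi> v"
      using complex_facet_of_polar_eq_facets_containing[OF P assms(3,4) \<tau>(1)] by blast
    \<comment> \<open>Nonemptiness of \<tau> makes \<sigma> a proper subset of the index set, so its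
      hull is a proper face.\<close>
    have sub: "\<tau> \<subseteq> {1..m}" "\<tau> \<noteq> {}"
      using v facets_containing_nonempty[OF P assms(3,4)] by (auto simp: facets_containing_def)
    \<comment> \<open>A non-maximal \<sigma> is handled directly by taking
      \<open>I = {1..m} - \<sigma>\<close>, which contains \<tau> and whose complement is
      \<sigma>.\<close>
    have "{1..m} - ({1..m} - \<sigma>) = \<sigma>" using \<tau>(2) by blast
    moreover have "\<sigma> \<subset> {1..m}" using \<tau>(2) sub by blast
    moreover have "facets_containing m \<Phi> v \<subseteq> {1..m} - \<sigma>" using v(2) \<tau>(2) sub by blast
    ultimately show ?thesis
      using face[OF v(1), of "{1..m} - \<sigma>"] associated_polytope_hull_proper[OF assms(13)] by auto
  qed
  moreover have "facets_containing m \<Phi> v \<subseteq> {1..m}" for v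
    by (auto simp: facets_containing_def)
  ultimately show ?thesis
    using face unfolding realized_in_boundary_def by blast
qed

end
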